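(* Let $q$ be a prime power and $n$ a positive integer. Then $\mathcal{C}(n,q)$ is a binary linear code of length $q^{\frac{n(n+1)}{2}}$ and dimension $k_1\le q^{\frac{n^2-n}{2}}(q-1)^n$, and $\mathcal{C}^T(n,q)$ is a binary linear code of length $\frac{q^n-1}{q-1}q^{\frac{n^2+n-2}{2}}$ and dimension $k_2\le \frac{q^n-1}{q-1}q^{\frac{n^2+n-2}{2}}-q^{\frac{n(n+1)}{2}}+q^{\frac{n^2-n}{2}}(q-1)^n$.
   Context: $\mathbb{S}_n(\mathbb{F}_q)$ denotes the set of $n\times n$ symmetric matrices over $\mathbb{F}_q$ (its elements are called points). Two points $S,S'$ are adjacent if $\operatorname{rank}(S-S')=1$. A line is a maximal set of rank $1$: a subset $\mathcal{M}\subseteq\mathbb{S}_n(\mathbb{F}_q)$ such that any two distinct points of $\mathcal{M}$ are adjacent and no point outside $\mathcal{M}$ is adjacent to every point of $\mathcal{M}$. $H(n,q)$ is the binary matrix with rows indexed by the lines and columns indexed by the points, whose (line, point) entry is $1$ iff the point belongs to the line. $\mathcal{C}(n,q)=\{c\in\mathbb{F}_2^{\text{points}}: H(n,q)c=0\}$ and $\mathcal{C}^T(n,q)=\{c\in\mathbb{F}_2^{\text{lines}}: H(n,q)^Tc=0\}$. *)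

theory Defs
  imports
    "Jordan_Normal_Form.DL_Rank"
    "HOL-Library.Z2"
    "HOL-Library.Function_Algebras"
    "HOL-Number_Theory.Prime_Powers"
begin

definition sym_mats :: "nat \<Rightarrow> 'a::field mat set" where
  "sym_mats n = {S \<in> carrier_mat n n. transpose_mat S = S}"

definition adjacent :: "nat \<Rightarrow> 'a::field mat \<Rightarrow> 'a mat \<Rightarrow> bool" where
  "adjacent n S S' \<longleftrightarrow> vec_space.rank n (S - S') = 1"

definition lines :: "nat \<Rightarrow> 'a::field mat set set" where
  "lines n = {M. M \<subseteq> sym_mats n \<and>
     (\<forall>S\<in>M. \<forall>S'\<in>M. S \<noteq> S' \<longrightarrow> adjacent n S S') \<and>
     \<not> (\<exists>S\<in>sym_mats n - M. \<forall>S'\<in>M. adjacent n S S')}"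

definition incidence :: "'a::field mat set \<Rightarrow> 'a mat \<Rightarrow> bit" where
  "incidence M S = (if S \<in> M then 1 else 0)"

(* The coordinate space of vectors over the two-element field with entries indexed by J:
   entries outside J are fixed to 0, so that a vector is determined by its entries on J. *)

definition binary_space :: "'i set \<Rightarrow> ('i \<Rightarrow> bit) set" where
  "binary_space J = {c. \<forall>j. j \<notin> J \<longrightarrow> c j = 0}"

(* A matrix with rows indexed by I and columns indexed by J is a curried function, of which only
   the values on I and J matter. *)

definition null_space :: "'r set \<Rightarrow> 'i set \<Rightarrow> ('r \<Rightarrow> 'i \<Rightarrow> bit) \<Rightarrow> ('i \<Rightarrow> bit) set" where
  "null_space I J H = {c \<in> binary_space J. \<forall>i\<in>I. (\<Sum>j\<in>J. H i j * c j) = 0}"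

definition bit_scale :: "bit \<Rightarrow> ('i \<Rightarrow> bit) \<Rightarrow> 'i \<Rightarrow> bit" where
  "bit_scale a c = (\<lambda>i. a * c i)"

global_interpretation binary: vector_space bit_scale
  by unfold_locales (auto simp: bit_scale_def fun_eq_iff algebra_simps)

definition binary_linear_code :: "'i set \<Rightarrow> ('i \<Rightarrow> bit) set \<Rightarrow> bool" where
  "binary_linear_code J C \<longleftrightarrow> finite J \<and> C \<subseteq> binary_space J \<and> binary.subspace C"

definition point_code :: "nat \<Rightarrow> ('a::field mat \<Rightarrow> bit) set" where
  "point_code n = null_space (lines n) (sym_mats n) incidence"

definition line_code :: "nat \<Rightarrow> ('a::field mat set \<Rightarrow> bit) set" where
  "line_code n = null_space (sym_mats n) (lines n) (\<lambda>S M. incidence M S)"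

end

theory Submission
  imports Defs "HOL-Library.Cardinality"
begin

text \<open>
  Every line has the form \<open>{S + a x x\<^sup>T | a}\<close> with \<open>x \<noteq> 0\<close>, because two rank one symmetric
  matrices with non-proportional directions differ by a matrix with a nonzero principal
  \<open>2 \<times> 2\<close> minor. The pairs \<open>(S, x)\<close> that give the same line number \<open>q (q - 1)\<close>, which counts the
  lines.

  For the dimensions, let \<open>P\<close> be the set of points with some zero diagonal entry, and send
  \<open>S \<in> P\<close> to the line through \<open>S\<close> in the direction of the unit vector at its first zero diagonal
  entry. All other points of that line have one zero fewer on the diagonal. So the incidence matrix
  restricted to these lines and to \<open>P\<close> is unitriangular, and the values of a codeword outside \<open>P\<close>
  (respectively, outside the chosen lines) determine it. The points outside \<open>P\<close> have
  \<open>(q - 1)\<^sup>n\<close> possible diagonals.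
\<close>

section \<open>Null spaces of triangular systems\<close>

text \<open>Restriction to the coordinates in \<open>K\<close> is linear and injective on
  \<open>V\<close>, so it carries a basis of \<open>V\<close> to an independent set inside the span
  of the unit vectors at \<open>K\<close>.\<close>

lemma linear_code_dim_le:
  fixes V :: "('i \<Rightarrow> bit) set"
  assumes V: "binary.subspace V" and K: "finite K"
    and inj: "\<And>c. c \<in> V \<Longrightarrow> (\<And>k. k \<in> K \<Longrightarrow> c k = 0) \<Longrightarrow> c = 0"
  shows "binary.dim V \<le> card K"
proof -
  define \<pi> :: "('i \<Rightarrow> bit) \<Rightarrow> 'i \<Rightarrow> bit" where "\<pi> c = (\<lambda>i. if i \<in> K then c i else 0)" for c
  define E :: "('i \<Rightarrow> bit) set" where "E = (\<lambda>k i. if i = k then 1 else 0) ` K"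
  interpret vector_space_pair "bit_scale :: bit \<Rightarrow> ('i \<Rightarrow> bit) \<Rightarrow> _" "bit_scale :: bit \<Rightarrow> ('i \<Rightarrow> bit) \<Rightarrow> _" ..
  obtain B where B: "B \<subseteq> V" "binary.independent B" "V \<subseteq> binary.span B" "card B = binary.dim V"
    using binary.basis_exists by blast
  have span: "binary.span B = V"
    using B V binary.span_minimal by blast
  have lin: "Vector_Spaces.linear bit_scale bit_scale \<pi>"
    by unfold_locales (auto simp: \<pi>_def bit_scale_def fun_eq_iff)
  have injV: "inj_on \<pi> V"
  proof
    fix c d assume cd: "c \<in> V" "d \<in> V" "\<pi> c = \<pi> d"
    have "c - d = 0"
    proof (rule inj)
      show "c - d \<in> V" using binary.subspace_diff[OF V] cd by blast
      show "(c - d) k = 0" if "k \<in> K" for k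
        using fun_cong[OF cd(3), of k] that by (simp add: \<pi>_def)
    qed
    then show "c = d" by simp
  qed
  have ind: "binary.independent (\<pi> ` B)"
    using linear_independent_injective_image[OF lin B(2)] injV span by simp
  have "\<pi> ` B \<subseteq> binary.span E"
  proof
    fix d assume "d \<in> \<pi> ` B"
    then obtain c where d: "d = \<pi> c" by blast
    have "d = (\<Sum>k\<in>K. bit_scale (c k) (\<lambda>i. if i = k then 1 else 0))"
    proof
      fix i
      have "(\<Sum>k\<in>K. bit_scale (c k) (\<lambda>i. if i = k then 1 else 0)) i
          = (\<Sum>k\<in>K. if i = k then c k else 0)"
        by (induction K rule: infinite_finite_induct) (auto simp: bit_scale_def)
      then show "d i = (\<Sum>k\<in>K. bit_scale (c k) (\<lambda>i. if i = k then 1 else 0)) i"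
        using K by (simp add: d \<pi>_def)
    qed
    also have "\<dots> \<in> binary.span E"
      by (intro binary.span_sum binary.span_scale binary.span_base) (auto simp: E_def)
    finally show "d \<in> binary.span E" .
  qed
  then have "card (\<pi> ` B) \<le> card E"
    using binary.independent_span_bound[OF _ ind] K by (auto simp: E_def)
  also have "card E \<le> card K"
    unfolding E_def using K by (rule card_image_le)
  also have "card (\<pi> ` B) = card B"
    using injV B(1) by (intro card_image) (rule inj_on_subset)
  finally show ?thesis using B(4) by simp
qed

lemma subspace_null_space: "binary.subspace (null_space R C H)"
proof (rule binary.subspaceI)
  show "0 \<in> null_space R C H"
    by (simp add: null_space_def binary_space_def)
next
  fix c d assume "c \<in> null_space R C H" "d \<in> null_space R C H"
  moreover have "(\<Sum>j\<in>C. H i j * (c + d) j) = (\<Sum>j\<in>C. H i j * c j) + (\<Sum>j\<in>C. H i j * d j)" for i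
    unfolding plus_fun_apply distrib_left sum.distrib ..
  \<comment> \<open>The default rules turn sums and products of bits into \<open>XOR\<close> and
    \<open>AND\<close>; without them the ring form matches the splitting above.\<close>
  ultimately show "c + d \<in> null_space R C H"
    by (simp add: null_space_def binary_space_def del: mult_bit_eq_and add_bit_eq_xor)
next
  fix a c assume "c \<in> null_space R C H"
  moreover have "(\<Sum>j\<in>C. H i j * bit_scale a c j) = a * (\<Sum>j\<in>C. H i j * c j)" for i
    unfolding bit_scale_def mult.left_commute[of _ a] sum_distrib_left ..
  ultimately show "bit_scale a c \<in> null_space R C H"
    by (auto simp: null_space_def binary_space_def) (simp_all add: bit_scale_def)
qed

text \<open>The equation in row \<open>r p\<close> expresses the entry at \<open>s p\<close> through
  entries off the pivot columns and pivots of smaller \<open>f\<close>. By induction on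
  \<open>f\<close>, a codeword vanishing off the pivot columns is zero, so the remaining columns
  bound the dimension.\<close>

lemma dim_null_space_triangular_le:
  fixes f :: "'p \<Rightarrow> nat"
  assumes fin: "finite C" and r: "r ` P \<subseteq> R" and s: "s ` P \<subseteq> C" "inj_on s P"
    and diag: "\<And>p. p \<in> P \<Longrightarrow> H (r p) (s p) = 1"
    and tri: "\<And>p p'. p \<in> P \<Longrightarrow> p' \<in> P \<Longrightarrow> p' \<noteq> p \<Longrightarrow> H (r p) (s p') \<noteq> 0 \<Longrightarrow> f p' < f p"
  shows "binary.dim (null_space R C H) \<le> card C - card P"
proof -
  have "binary.dim (null_space R C H) \<le> card (C - s ` P)"
  proof (rule linear_code_dim_le[OF subspace_null_space])
    fix c assume c: "c \<in> null_space R C H" and 0: "\<And>k. k \<in> C - s ` P \<Longrightarrow> c k = 0"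
    have "c (s p) = 0" if "p \<in> P" for p
      using that
    proof (induction "f p" arbitrary: p rule: less_induct)
      case less
      \<comment> \<open>Off the pivot columns \<open>c\<close> vanishes; in another pivot column
        with nonzero coefficient, \<open>f\<close> is smaller and the induction hypothesis
        applies.\<close>
      have rest: "H (r p) j * c j = 0" if j: "j \<in> C - {s p}" for j
      proof (cases "j \<in> s ` P")
        case True
        then obtain p' where "p' \<in> P" "j = s p'" by blast
        then have "H (r p) j = 0 \<or> c j = 0"
          using j less.prems tri[of p p'] less.hyps[of p'] by blast
        then show ?thesis by auto
      qed (use 0 j in auto)
      moreover have "0 = (\<Sum>j\<in>C. H (r p) j * c j)"
        using c r less.prems by (auto simp: null_space_def)
      moreover have "\<dots> = H (r p) (s p) * c (s p) + (\<Sum>j\<in>C - {s p}. H (r p) j * c j)"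
        using fin s less.prems by (intro sum.remove) auto
      moreover have "\<dots> = c (s p)"
        by (subst sum.neutral) (use rest diag[OF less.prems] in \<open>blast, simp\<close>)
      ultimately show ?case by (simp only:)
    qed
    then have "c j = 0" for j
      using 0[of j] c unfolding null_space_def binary_space_def by blast
    then show "c = 0" by (simp add: fun_eq_iff)
  qed (use fin in auto)
  also have "\<dots> = card C - card P"
    using s fin by (simp add: card_Diff_subset finite_subset card_image)
  finally show ?thesis .
qed

section \<open>Rank one symmetric matrices and lines\<close>

text \<open>Two columns with a nonzero 2 by 2 minor are independent and would force rank at least
  2.\<close>

lemma minor_zero_of_rank_le_one:
  fixes A :: "'a::field mat"
  assumes A: "A \<in> carrier_mat n m" and rank: "vec_space.rank n A \<le> 1"
    and ij: "i < n" "k < n" "j < m" "l < m"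
  shows "A $$ (i,j) * A $$ (k,l) = A $$ (i,l) * A $$ (k,j)"
proof (rule ccontr)
  assume minor: "A $$ (i,j) * A $$ (k,l) \<noteq> A $$ (i,l) * A $$ (k,j)"
  interpret vec_space "TYPE('a)" n .
  let ?u = "col A j" and ?v = "col A l"
  \<comment> \<open>Independence concerns sets of vectors, so the columns must be distinct for the
    set to have two elements.\<close>
  have ne: "?u \<noteq> ?v"
  proof
    assume e: "?u = ?v"
    have "A $$ (i,j) = A $$ (i,l)" "A $$ (k,j) = A $$ (k,l)"
      using A ij arg_cong[OF e, of "\<lambda>v. v $ i"] arg_cong[OF e, of "\<lambda>v. v $ k"] by auto
    then show False using minor by simp
  qed
  have UV: "{?u, ?v} \<subseteq> carrier_vec n" using A ij by auto
  have "lin_indpt {?u, ?v}"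
  proof (rule finite_lin_indpt2)
    fix a assume a: "lincomb a {?u, ?v} = 0\<^sub>v n"
    have *: "a ?u * A $$ (t,j) + a ?v * A $$ (t,l) = 0" if "t < n" for t
      using arg_cong[OF a, of "\<lambda>v. v $ t"] lincomb_index[OF that UV, of a] ne that A ij
      by (auto simp: col_def)
    \<comment> \<open>Elimination as in Cramer's rule shows that the minor \<open>?d\<close>
      annihilates both coefficients.\<close>
    let ?d = "A $$ (i,j) * A $$ (k,l) - A $$ (i,l) * A $$ (k,j)"
    have "a ?u * ?d = A $$ (k,l) * (a ?u * A $$ (i,j) + a ?v * A $$ (i,l))
        - A $$ (i,l) * (a ?u * A $$ (k,j) + a ?v * A $$ (k,l))"
      by (simp add: algebra_simps)
    moreover have "a ?v * ?d = A $$ (i,j) * (a ?u * A $$ (k,j) + a ?v * A $$ (k,l))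
        - A $$ (k,j) * (a ?u * A $$ (i,j) + a ?v * A $$ (i,l))"
      by (simp add: algebra_simps)
    ultimately have "a ?u * ?d = 0" "a ?v * ?d = 0"
      using *[OF ij(1)] *[OF ij(2)] by simp_all
    then show "\<forall>v\<in>{?u, ?v}. a v = 0" using minor by auto
  qed (use UV in auto)
  moreover have "{?u, ?v} \<subseteq> set (cols A)" using A ij by (auto simp: cols_def)
  ultimately have "card {?u, ?v} \<le> rank A" by (intro rank_ge_card_indpt[OF A])
  then show False using rank ne by simp
qed

text \<open>Extensional functions represent each nonzero vector of length \<open>n\<close> exactly
  once, so that directions can be counted.\<close>

definition directions :: "nat \<Rightarrow> (nat \<Rightarrow> 'a::field) set" where
  "directions n = {x \<in> {..<n} \<rightarrow>\<^sub>E UNIV. \<exists>i<n. x i \<noteq> 0}"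

text \<open>The matrix \<open>S + a x x^T\<close>. The scalar is kept separate since a nonsquare
  \<open>a\<close> cannot be absorbed into \<open>x\<close>.\<close>

definition translate :: "nat \<Rightarrow> 'a::field mat \<Rightarrow> (nat \<Rightarrow> 'a) \<Rightarrow> 'a \<Rightarrow> 'a mat" where
  "translate n S x a = mat n n (\<lambda>(i, j). S $$ (i, j) + a * x i * x j)"

definition line_through :: "nat \<Rightarrow> 'a::field mat \<Rightarrow> (nat \<Rightarrow> 'a) \<Rightarrow> 'a mat set" where
  "line_through n S x = range (translate n S x)"

lemma sym_mats_carrier: "S \<in> sym_mats n \<Longrightarrow> S \<in> carrier_mat n n"
  by (simp add: sym_mats_def)

lemma sym_mats_sym:
  assumes "S \<in> sym_mats n" "i < n" "j < n"
  shows "S $$ (i, j) = S $$ (j, i)"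
proof -
  have "transpose_mat S = S" "S \<in> carrier_mat n n" using assms by (auto simp: sym_mats_def)
  then have "S $$ (i, j) = transpose_mat S $$ (i, j)" by simp
  also have "\<dots> = S $$ (j, i)" using assms \<open>S \<in> carrier_mat n n\<close> by auto
  finally show ?thesis .
qed

lemma sym_matsI:
  assumes "S \<in> carrier_mat n n" "\<And>i j. i < n \<Longrightarrow> j < n \<Longrightarrow> S $$ (i, j) = S $$ (j, i)"
  shows "S \<in> sym_mats n"
  using assms by (auto simp: sym_mats_def intro!: eq_matI)

lemma index_translate [simp]:
  "i < n \<Longrightarrow> j < n \<Longrightarrow> translate n S x a $$ (i, j) = S $$ (i, j) + a * x i * x j"
  by (simp add: translate_def)

lemma translate_in_sym_mats: "S \<in> sym_mats n \<Longrightarrow> translate n S x a \<in> sym_mats n"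
  by (rule sym_matsI) (auto simp: translate_def sym_mats_sym ac_simps)

lemma sym_mats_eqI:
  assumes "S \<in> sym_mats n" "T \<in> sym_mats n"
    and "\<And>i j. i < n \<Longrightarrow> j < n \<Longrightarrow> S $$ (i, j) = T $$ (i, j)"
  shows "S = T"
proof -
  have dims: "dim_row S = n" "dim_col S = n" "dim_row T = n" "dim_col T = n"
    using sym_mats_carrier[OF assms(1)] sym_mats_carrier[OF assms(2)] by auto
  show ?thesis by (rule eq_matI) (simp_all only: dims assms(3))
qed

lemma translate_zero: "S \<in> sym_mats n \<Longrightarrow> translate n S x 0 = S"
  by (rule sym_mats_eqI) (auto simp: translate_in_sym_mats)

lemma translate_translate:
  "S \<in> sym_mats n \<Longrightarrow> translate n (translate n S x a) x b = translate n S x (a + b)"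
  by (rule sym_mats_eqI[of _ n]) (auto simp: translate_in_sym_mats algebra_simps)

lemma translate_scale:
  assumes "S \<in> sym_mats n" "\<And>i. i < n \<Longrightarrow> y i = c * x i"
  shows "translate n S y a = translate n S x (a * c * c)"
  using assms by (intro sym_mats_eqI[of _ n]) (auto simp: translate_in_sym_mats ac_simps)

lemma translate_inject:
  assumes "x \<in> directions n"
  shows "translate n S x a = translate n S x b \<longleftrightarrow> a = b"
proof
  assume eq: "translate n S x a = translate n S x b"
  obtain i where i: "i < n" "x i \<noteq> 0" using assms by (auto simp: directions_def)
  have "translate n S x a $$ (i, i) = translate n S x b $$ (i, i)" using eq by simp
  then show "a = b" using i by simp
qed simp

section \<open>Adjacency in terms of translates\<close>

lemma adjacentD_minor:
  assumes "adjacent n S T" "S \<in> sym_mats n" "T \<in> sym_mats n" "i < n" "j < n" "k < n" "l < n"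
  shows "(S - T) $$ (i,j) * (S - T) $$ (k,l) = (S - T) $$ (i,l) * (S - T) $$ (k,j)"
proof (rule minor_zero_of_rank_le_one)
  show "S - T \<in> carrier_mat n n" using assms(3) by (intro minus_carrier_mat sym_mats_carrier)
  show "vec_space.rank n (S - T) \<le> 1" using assms(1) by (simp add: adjacent_def)
qed fact+

lemma not_adjacent_self:
  assumes "S \<in> sym_mats n"
  shows "\<not> adjacent n S S"
proof -
  have "S - S = 0\<^sub>m n n" using sym_mats_carrier[OF assms] by auto
  then show ?thesis by (simp add: adjacent_def vec_space.rank_0I)
qed

text \<open>The difference is \<open>(a - b) x x^T\<close>, whose entries are products, so its rank
  is at most 1; a nonzero diagonal entry excludes rank 0.\<close>

lemma translate_adjacent:
  fixes S :: "'a::field mat"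
  assumes S: "S \<in> sym_mats n" and x: "x \<in> directions n" and ab: "a \<noteq> b"
  shows "adjacent n (translate n S x a) (translate n S x b)"
proof -
  interpret vec_space "TYPE('a)" n .
  obtain i where i: "i < n" "x i \<noteq> 0" using x by (auto simp: directions_def)
  define A where "A = translate n S x a - translate n S x b"
  have A: "A \<in> carrier_mat n n" unfolding A_def translate_def by (intro minus_carrier_mat mat_carrier)
  have A_index: "A $$ (r, c) = ((a - b) * x r) * x c" if "r < n" "c < n" for r c
    using that by (auto simp: A_def translate_def algebra_simps)
  have "rank A \<le> 1"
    using A A_index by (intro rank_le_1_product_entries[of A n "\<lambda>r. (a - b) * x r" x]) auto
  moreover have "rank A \<noteq> 0"
  proof
    assume "rank A = 0"
    have A_ii: "A $$ (i, i) \<noteq> 0" using A_index i ab by simp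
    have "lin_indpt {col A i}"
    proof (rule finite_lin_indpt2)
      fix c assume "lincomb c {col A i} = 0\<^sub>v n"
      then have "c (col A i) * col A i $ i = 0"
        using lincomb_index[OF i(1), of "{col A i}" c] A i by simp
      then show "\<forall>v\<in>{col A i}. c v = 0" using A A_ii i by simp
    qed (use A i in auto)
    then have "card {col A i} \<le> rank A"
      using A i by (intro rank_ge_card_indpt[OF A]) (auto simp: cols_def)
    then show False using \<open>rank A = 0\<close> by simp
  qed
  ultimately show ?thesis by (simp add: adjacent_def A_def)
qed

text \<open>A symmetric matrix of rank one has a nonzero diagonal entry, and its row through
  that entry spans it.\<close>

lemma adjacent_imp_translate:
  assumes adj: "adjacent n T S" and S: "S \<in> sym_mats n" and T: "T \<in> sym_mats n"
  obtains a x where "x \<in> directions n" "a \<noteq> 0" "T = translate n S x a"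
proof -
  define A where "A = T - S"
  have TS: "S \<in> carrier_mat n n" "T \<in> carrier_mat n n" using S T by (auto simp: sym_mats_carrier)
  have A_sym: "A $$ (i, j) = A $$ (j, i)" if "i < n" "j < n" for i j
    using TS that sym_mats_sym[OF S that] sym_mats_sym[OF T that] by (auto simp: A_def)
  have minor: "A $$ (i,j) * A $$ (k,l) = A $$ (i,l) * A $$ (k,j)"
    if "i < n" "j < n" "k < n" "l < n" for i j k l
    using adjacentD_minor[OF adj T S that] by (simp add: A_def)
  \<comment> \<open>With a zero diagonal, the principal minors would give
    \<open>A_ij^2 = A_ii A_jj = 0\<close>, also in characteristic 2, and \<open>T\<close> would
    equal \<open>S\<close>.\<close>
  have "\<exists>p<n. A $$ (p, p) \<noteq> 0"
  proof (rule ccontr)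
    assume "\<not> ?thesis"
    then have 0: "A $$ (i, i) = 0" if "i < n" for i using that by blast
    have "T $$ (i, j) = S $$ (i, j)" if "i < n" "j < n" for i j
      using minor[OF that that(2) that(1)] minor[of i i j j] 0 A_sym[OF that] that TS
      by (auto simp: A_def)
    then have "T = S" using S T by (intro sym_mats_eqI)
    then show False using adj S not_adjacent_self by blast
  qed
  then obtain p where p: "p < n" "A $$ (p, p) \<noteq> 0" by blast
  \<comment> \<open>The minor on rows \<open>p, i\<close> and columns \<open>p, j\<close> gives
    \<open>A_ij = A_pi A_pj / A_pp\<close>. Taking row \<open>p\<close> as direction and
    \<open>1 / A_pp\<close> as scalar avoids square roots.\<close>
  define x where "x = (\<lambda>i\<in>{..<n}. A $$ (p, i))"
  show thesis
  proof
    show "x \<in> directions n" using p by (auto simp: directions_def x_def)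
    show "inverse (A $$ (p, p)) \<noteq> 0" using p by simp
    show "T = translate n S x (inverse (A $$ (p, p)))"
    proof (rule sym_mats_eqI[OF T translate_in_sym_mats[OF S]])
      fix i j assume ij: "i < n" "j < n"
      have "A $$ (p, p) * A $$ (i, j) = A $$ (p, i) * A $$ (p, j)"
        using minor[OF p(1) p(1) ij] A_sym[OF ij(1) p(1)] by (simp add: mult.commute)
      then have "A $$ (i, j) = inverse (A $$ (p, p)) * A $$ (p, i) * A $$ (p, j)"
        using p by (simp add: field_simps)
      moreover have "T $$ (i, j) = S $$ (i, j) + A $$ (i, j)" using ij TS by (simp add: A_def)
      ultimately show "T $$ (i, j) = translate n S x (inverse (A $$ (p, p))) $$ (i, j)"
        using ij by (simp add: x_def)
    qed
  qed
qed

lemma translate_adjacent_self: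
  assumes "S \<in> sym_mats n" "x \<in> directions n" "a \<noteq> 0"
  shows "adjacent n (translate n S x a) S"
  using translate_adjacent[of S n x a 0] assms by (simp add: translate_zero)

section \<open>Lines through a point in a given direction\<close>

lemma translate_in_line [simp]: "translate n S x a \<in> line_through n S x"
  by (simp add: line_through_def)

lemma base_in_line: "S \<in> sym_mats n \<Longrightarrow> S \<in> line_through n S x"
  using translate_in_line[of n S x 0] by (simp add: translate_zero)

text \<open>Scaling the direction by \<open>c\<close> only reparametrizes the line: \<open>a\<close>
  becomes \<open>a * c * c\<close>, a bijection of the field.\<close>

lemma line_through_scale:
  assumes "S \<in> sym_mats n" "c \<noteq> 0" "\<And>i. i < n \<Longrightarrow> y i = c * x i"
  shows "line_through n S y = line_through n S x"
proof -
  have "translate n S y a = translate n S x (a * c * c)" for a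
    using assms translate_scale by blast
  moreover have "translate n S x a = translate n S y (a / (c * c))" for a
    using translate_scale[OF assms(1,3), where a = "a / (c * c)"] assms(2) by simp
  ultimately show ?thesis unfolding line_through_def by (metis (no_types, lifting) image_subset_iff rangeI subset_antisym)
qed

lemma line_through_translate:
  assumes "S \<in> sym_mats n"
  shows "line_through n (translate n S x a) x = line_through n S x"
proof -
  have "translate n (translate n S x a) x = translate n S x \<circ> (+) a"
    using assms by (simp add: fun_eq_iff translate_translate)
  then show ?thesis unfolding line_through_def by (simp only: image_comp[symmetric] surj_plus)
qed

text \<open>The principal minor of \<open>b y y^T - a x x^T\<close> on rows \<open>i, j\<close> is
  \<open>- a b (x_i y_j - x_j y_i)^2\<close>. It vanishes when the rank is at most 1, hence also
  when the two points coincide.\<close>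

lemma adjacent_translates_imp_proportional:
  assumes S: "S \<in> sym_mats n" and x: "x \<in> directions n" and ab: "a \<noteq> 0" "b \<noteq> 0"
    and adj: "adjacent n (translate n S y b) (translate n S x a) \<or> translate n S y b = translate n S x a"
    and y: "y \<in> directions n"
  shows "\<exists>c. c \<noteq> 0 \<and> (\<forall>i<n. y i = c * x i)"
proof -
  have det: "x i * y j = x j * y i" if ij: "i < n" "j < n" for i j
  proof -
    have D: "(translate n S y b - translate n S x a) $$ (k, l) = b * y k * y l - a * x k * x l"
      if "k < n" "l < n" for k l using that by (simp add: translate_def)
    have "(b * y i * y i - a * x i * x i) * (b * y j * y j - a * x j * x j)
        = (b * y i * y j - a * x i * x j) * (b * y j * y i - a * x j * x i)"
    proof (cases "translate n S y b = translate n S x a")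
      case True
      have "b * y k * y l - a * x k * x l = 0" if "k < n" "l < n" for k l
        using arg_cong[OF True, of "\<lambda>A. A $$ (k, l)"] that by simp
      then show ?thesis using ij by simp
    next
      case False
      then show ?thesis
        using adjacentD_minor[of n "translate n S y b" "translate n S x a" i i j j] adj S ij
        by (simp add: D translate_in_sym_mats del: index_minus_mat)
    qed
    then have "a * b * ((x i * y j - x j * y i) * (x i * y j - x j * y i)) = 0"
      by (simp add: algebra_simps)
    then show ?thesis using ab by simp
  qed
  \<comment> \<open>The factor is read off at a nonzero coordinate of \<open>x\<close>; it is
    nonzero because \<open>y\<close> is.\<close>
  obtain p where p: "p < n" "x p \<noteq> 0" using x by (auto simp: directions_def)
  have *: "y i = (y p / x p) * x i" if "i < n" for i
    using det[OF p(1) that] p by (simp add: field_simps)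
  moreover have "y p / x p \<noteq> 0" using * y by (auto simp: directions_def)
  ultimately show ?thesis by blast
qed

text \<open>From \<open>S\<close>, the point \<open>U\<close> lies in some direction
  \<open>y\<close>; its relation to a second point of the line makes \<open>y\<close> proportional
  to \<open>x\<close>. So two points of a line determine it.\<close>

lemma adjacent_to_two_imp_collinear:
  assumes S: "S \<in> sym_mats n" and x: "x \<in> directions n" and a: "a \<noteq> 0" and U: "U \<in> sym_mats n"
    and US: "adjacent n U S" and UT: "adjacent n U (translate n S x a) \<or> U = translate n S x a"
  shows "U \<in> line_through n S x"
proof -
  obtain b y where y: "y \<in> directions n" "b \<noteq> 0" "U = translate n S y b"
    using adjacent_imp_translate[OF US S U] by blast
  have "adjacent n (translate n S y b) (translate n S x a) \<or> translate n S y b = translate n S x a"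
    using UT y(3) by simp
  from adjacent_translates_imp_proportional[OF S x a y(2) this y(1)]
  obtain c where "c \<noteq> 0" "\<forall>i<n. y i = c * x i" by blast
  then have "line_through n S y = line_through n S x" using line_through_scale[OF S] by blast
  then show ?thesis using y(3) translate_in_line by blast
qed

lemma line_through_clique:
  assumes S: "S \<in> sym_mats n" and x: "x \<in> directions n"
    and T: "T \<in> line_through n S x" and U: "U \<in> line_through n S x" and "T \<noteq> U"
  shows "adjacent n T U"
proof -
  obtain a b where ab: "T = translate n S x a" "U = translate n S x b"
    using T U unfolding line_through_def by (elim rangeE)
  then have "a \<noteq> b" using \<open>T \<noteq> U\<close> by blast
  then show ?thesis unfolding ab by (rule translate_adjacent[OF S x])
qed

text \<open>For maximality two points of the line suffice: whatever is adjacent to \<open>S\<close>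
  and to \<open>S + x x^T\<close> is already on the line.\<close>

lemma line_through_in_lines:
  fixes S :: "'a::field mat"
  assumes S: "S \<in> sym_mats n" and x: "x \<in> directions n"
  shows "line_through n S x \<in> lines n"
proof -
  have "adjacent n T U" if "T \<in> line_through n S x" "U \<in> line_through n S x" "T \<noteq> U" for T U
    using line_through_clique[OF S x that] .
  moreover have "U \<in> line_through n S x"
    if U: "U \<in> sym_mats n" and adj: "\<forall>T\<in>line_through n S x. adjacent n U T" for U
  proof (rule adjacent_to_two_imp_collinear[OF S x one_neq_zero U])
    show "adjacent n U S" using adj base_in_line[OF S] by blast
    show "adjacent n U (translate n S x 1) \<or> U = translate n S x 1"
      using adj translate_in_line by blast
  qed
  moreover have "line_through n S x \<subseteq> sym_mats n"
    using translate_in_sym_mats[OF S] by (auto simp: line_through_def)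
  ultimately show ?thesis
    unfolding lines_def mem_Collect_eq Bex_def Diff_iff by blast
qed

text \<open>A maximal clique has two distinct points, which fix a base point and a direction. All
  its points lie on the resulting line, and maximality then forces the whole line into it.\<close>

lemma lines_eq:
  assumes n: "n \<ge> 1"
  shows "(lines n :: 'a::field mat set set) = (\<lambda>(S, x). line_through n S x) ` (sym_mats n \<times> directions n)"
proof
  show "(lines n :: 'a mat set set) \<subseteq> (\<lambda>(S, x). line_through n S x) ` (sym_mats n \<times> directions n)"
  proof
    fix M :: "'a mat set" assume M: "M \<in> lines n"
    have sub: "M \<subseteq> sym_mats n" and adj: "\<And>S T. S \<in> M \<Longrightarrow> T \<in> M \<Longrightarrow> S \<noteq> T \<Longrightarrow> adjacent n S T"
      and max: "\<And>S. S \<in> sym_mats n \<Longrightarrow> S \<notin> M \<Longrightarrow> \<exists>T\<in>M. \<not> adjacent n S T"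
      using M by (auto simp: lines_def)
    \<comment> \<open>The empty set is not maximal, since any point is vacuously adjacent to all its
      elements.\<close>
    have "0\<^sub>m n n \<in> sym_mats n" by (rule sym_matsI) auto
    then obtain S where SM: "S \<in> M" using max by blast
    then have S: "S \<in> sym_mats n" using sub by blast
    obtain T where T: "T \<in> M" "T \<noteq> S"
    proof (rule ccontr)
      assume "\<not> thesis"
      then have "M = {S}" using SM that by blast
      \<comment> \<open>The all-ones vector serves as some direction, nonzero as
        \<open>n \<ge> 1\<close>; translating \<open>S\<close> along it shows that a single point is
        not maximal.\<close>
      define e :: "nat \<Rightarrow> 'a" where "e = (\<lambda>i\<in>{..<n}. 1)"
      have "e \<in> directions n" using n by (auto simp: directions_def e_def intro!: exI[of _ 0])
      then have *: "adjacent n (translate n S e 1) S" using S translate_adjacent_self by fastforce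
      then have "translate n S e 1 \<noteq> S" using S not_adjacent_self by metis
      then show False using max[of "translate n S e 1"] * S \<open>M = {S}\<close> translate_in_sym_mats by blast
    qed
    obtain a x where x: "x \<in> directions n" "a \<noteq> 0" "T = translate n S x a"
      using adjacent_imp_translate[of n T S] adj T SM sub by blast
    have M_sub: "M \<subseteq> line_through n S x"
    proof
      fix U assume U: "U \<in> M"
      show "U \<in> line_through n S x"
      proof (cases "U = S")
        case False
        then show ?thesis
          using adjacent_to_two_imp_collinear[OF S x(1,2), of U] adj U SM T x(3) sub by blast
      qed (use base_in_line S in blast)
    qed
    have "line_through n S x \<subseteq> M"
    proof
      fix U assume U: "U \<in> line_through n S x"
      have "U \<in> sym_mats n" using U S by (auto simp: line_through_def translate_in_sym_mats)
      moreover have "adjacent n U V" if V: "V \<in> M" and "U \<notin> M" for V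
      proof -
        have "V \<in> line_through n S x" "U \<noteq> V" using V M_sub \<open>U \<notin> M\<close> by blast+
        then show ?thesis using line_through_clique[OF S x(1) U] by blast
      qed
      ultimately show "U \<in> M" using max by blast
    qed
    then have "M = line_through n S x" using M_sub by (intro subset_antisym)
    then show "M \<in> (\<lambda>(S, x). line_through n S x) ` (sym_mats n \<times> directions n)"
      using S x(1) by (intro image_eqI[of _ _ "(S, x)"]) simp_all
  qed
  show "(\<lambda>(S, x). line_through n S x) ` (sym_mats n \<times> directions n) \<subseteq> (lines n :: 'a mat set set)"
    by (rule image_subsetI) (clarsimp simp: line_through_in_lines)
qed

text \<open>A line may be based at any of its points, and its direction is unique up to a nonzero
  factor. The two parameters \<open>a\<close> and \<open>c\<close> make the fibre countable by a
  product.\<close>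

lemma line_through_fibre:
  fixes S :: "'a::field mat"
  assumes S: "S \<in> sym_mats n" and x: "x \<in> directions n"
  shows "{(T, y). T \<in> sym_mats n \<and> y \<in> directions n \<and> line_through n T y = line_through n S x}
    = (\<lambda>(a, c). (translate n S x a, \<lambda>i\<in>{..<n}. c * x i)) ` (UNIV \<times> (UNIV - {0}))" (is "?F = ?G")
proof
  show "?F \<subseteq> ?G"
  proof clarify
    fix T y assume T: "T \<in> sym_mats n" and y: "y \<in> directions n"
      and eq: "line_through n T y = line_through n S x"
    obtain a where a: "T = translate n S x a"
      using base_in_line[OF T, of y] eq by (auto simp: line_through_def)
    have eq': "line_through n T y = line_through n T x"
      using eq line_through_translate[OF S, of x a] a by simp
    \<comment> \<open>A second point of the common line, written in both directions, ties
      \<open>y\<close> to \<open>x\<close>. Its parameter \<open>b\<close> is nonzero, as otherwise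
      \<open>T\<close> would be adjacent to itself.\<close>
    have "translate n T y 1 \<in> line_through n T x" using eq' translate_in_line by blast
    then obtain b where b: "translate n T y 1 = translate n T x b" by (auto simp: line_through_def)
    have "b \<noteq> 0"
      using b T y translate_zero[OF T] translate_adjacent_self[OF T y one_neq_zero] not_adjacent_self[OF T]
      by metis
    from adjacent_translates_imp_proportional[OF T x this one_neq_zero disjI2[OF b] y]
    obtain c where c: "c \<noteq> 0" "\<forall>i<n. y i = c * x i" by blast
    have "y = (\<lambda>i\<in>{..<n}. c * x i)"
    proof (rule extensionalityI)
      show "y \<in> extensional {..<n}" using y unfolding directions_def PiE_def by blast
    next
      show "(\<lambda>i\<in>{..<n}. c * x i) \<in> extensional {..<n}" by simp
      show "y i = (\<lambda>i\<in>{..<n}. c * x i) i" if "i \<in> {..<n}" for i using c(2) that by simp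
    qed
    then show "(T, y) \<in> ?G" using a c(1) by (intro image_eqI[of _ _ "(a, c)"]) simp_all
  qed
  have *: "(translate n S x a, \<lambda>i\<in>{..<n}. c * x i) \<in> ?F" if c: "c \<noteq> 0" for a c
  proof -
    let ?T = "translate n S x a" and ?y = "\<lambda>i\<in>{..<n}. c * x i"
    have "?y \<in> directions n" using c x by (auto simp: directions_def)
    moreover have "line_through n ?T ?y = line_through n S x"
      using line_through_scale[OF translate_in_sym_mats[OF S] c, of ?y x x a] line_through_translate[OF S]
      by simp
    ultimately show ?thesis
      using translate_in_sym_mats[OF S] by blast
  qed
  show "?G \<subseteq> ?F"
  proof (rule image_subsetI)
    fix p :: "'a \<times> 'a" assume "p \<in> UNIV \<times> (UNIV - {0})"
    then obtain a c where p: "p = (a, c)" "c \<noteq> 0" by blast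
    show "(case p of (a, c) \<Rightarrow> (translate n S x a, \<lambda>i\<in>{..<n}. c * x i)) \<in> ?F"
      unfolding p prod.case by (rule *[OF p(2)])
  qed
qed

section \<open>Counting points and lines\<close>

text \<open>The sum counts the entries strictly below the diagonal and serves as exponent below;
  this form avoids division and truncated subtraction.\<close>

lemma double_sum_lessThan: "2 * (\<Sum>j<n. j) + n = n\<^sup>2" for n :: nat
  by (induction n) (auto simp: power2_eq_square)

lemma card_directions:
  "card (directions n :: (nat \<Rightarrow> 'a::{field,finite}) set) = CARD('a) ^ n - 1"
proof -
  have "(directions n :: (nat \<Rightarrow> 'a) set) = ({..<n} \<rightarrow>\<^sub>E UNIV) - {\<lambda>i\<in>{..<n}. 0}"
    unfolding directions_def by (auto simp: PiE_def extensional_def fun_eq_iff)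
  then show ?thesis
    by (simp add: card_Diff_subset card_PiE)
qed

lemma finite_directions: "finite (directions n :: (nat \<Rightarrow> 'a::{field,finite}) set)"
  unfolding directions_def by (rule finite_subset[of _ "{..<n} \<rightarrow>\<^sub>E UNIV"]) (auto intro: finite_PiE)

text \<open>A symmetric matrix is determined by its lower triangle, indexed by \<open>I\<close>. The
  set \<open>D\<close> of allowed diagonal entries covers both the count of all points and that of
  points with no zero on the diagonal.\<close>

lemma bij_betw_sym_mats:
  fixes D :: "'a::field set" and n :: nat
  defines "I \<equiv> Sigma {..<n} (\<lambda>j. {..j})"
  shows "bij_betw (\<lambda>S. \<lambda>p\<in>I. S $$ p) {S \<in> sym_mats n. \<forall>i<n. S $$ (i, i) \<in> D}
    (\<Pi>\<^sub>E (j, i)\<in>I. if i = j then D else UNIV)"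
proof (rule bij_betw_byWitness[where f' = "\<lambda>f. mat n n (\<lambda>(i, j). if j \<le> i then f (i, j) else f (j, i))"])
  show "\<forall>S\<in>{S \<in> sym_mats n. \<forall>i<n. S $$ (i, i) \<in> D}.
      mat n n (\<lambda>(i, j). if j \<le> i then (\<lambda>p\<in>I. S $$ p) (i, j) else (\<lambda>p\<in>I. S $$ p) (j, i)) = S"
  proof
    fix S assume "S \<in> {S \<in> sym_mats n. \<forall>i<n. S $$ (i, i) \<in> D}"
    then have S: "S \<in> sym_mats n" by blast
    show "mat n n (\<lambda>(i, j). if j \<le> i then (\<lambda>p\<in>I. S $$ p) (i, j) else (\<lambda>p\<in>I. S $$ p) (j, i)) = S"
      by (rule eq_matI) (use sym_mats_carrier[OF S] sym_mats_sym[OF S] in \<open>auto simp: I_def\<close>)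
  qed
  show "\<forall>f\<in>\<Pi>\<^sub>E (j, i)\<in>I. if i = j then D else UNIV.
      (\<lambda>p\<in>I. mat n n (\<lambda>(i, j). if j \<le> i then f (i, j) else f (j, i)) $$ p) = f"
  proof
    fix f assume f: "f \<in> (\<Pi>\<^sub>E (j, i)\<in>I. if i = j then D else UNIV)"
    show "(\<lambda>p\<in>I. mat n n (\<lambda>(i, j). if j \<le> i then f (i, j) else f (j, i)) $$ p) = f"
    proof (rule extensionalityI)
      show "f \<in> extensional I" using f unfolding PiE_def by blast
    qed (auto simp: I_def)
  qed
  show "(\<lambda>S. \<lambda>p\<in>I. S $$ p) ` {S \<in> sym_mats n. \<forall>i<n. S $$ (i, i) \<in> D}
      \<subseteq> (\<Pi>\<^sub>E (j, i)\<in>I. if i = j then D else UNIV)"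
    by (auto simp: I_def split: if_splits)
  show "(\<lambda>f. mat n n (\<lambda>(i, j). if j \<le> i then f (i, j) else f (j, i))) ` (\<Pi>\<^sub>E (j, i)\<in>I. if i = j then D else UNIV)
      \<subseteq> {S \<in> sym_mats n. \<forall>i<n. S $$ (i, i) \<in> D}"
  proof (rule image_subsetI)
    fix f assume f: "f \<in> (\<Pi>\<^sub>E (j, i)\<in>I. if i = j then D else UNIV)"
    have "f (i, i) \<in> D" if "i < n" for i
      using PiE_mem[OF f, of "(i, i)"] that by (simp add: I_def)
    then show "mat n n (\<lambda>(i, j). if j \<le> i then f (i, j) else f (j, i))
        \<in> {S \<in> sym_mats n. \<forall>i<n. S $$ (i, i) \<in> D}"
      by (auto intro!: sym_matsI)
  qed
qed

text \<open>Row \<open>j\<close> of the lower triangle has \<open>j\<close> free entries and one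
  diagonal entry in \<open>D\<close>.\<close>

lemma card_sym_mats_diag_in:
  fixes D :: "'a::{field,finite} set"
  shows "card {S \<in> sym_mats n. \<forall>i<n. S $$ (i, i) \<in> D} = card D ^ n * CARD('a) ^ (\<Sum>j<n. j)"
proof -
  let ?T = "\<lambda>(j, i). if i = j then D else UNIV"
  have "card {S \<in> sym_mats n. \<forall>i<n. S $$ (i, i) \<in> D}
      = (\<Prod>p\<in>Sigma {..<n} (\<lambda>j. {..j}). card (?T p))"
    by (subst bij_betw_same_card[OF bij_betw_sym_mats]) (simp add: card_PiE case_prod_unfold)
  also have "\<dots> = (\<Prod>j<n. \<Prod>i\<le>j. card (?T (j, i)))"
    by (simp add: prod.Sigma case_prod_unfold)
  also have "\<dots> = (\<Prod>j<n. card D * CARD('a) ^ j)"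
  proof (rule prod.cong)
    fix j :: nat
    have "(\<Prod>i\<le>j. card (?T (j, i))) = card D * (\<Prod>i<j. card (?T (j, i)))"
      unfolding lessThan_Suc_atMost[symmetric] prod.lessThan_Suc by simp
    also have "(\<Prod>i<j. card (?T (j, i))) = (\<Prod>i<j. CARD('a))" by (rule prod.cong) auto
    finally show "(\<Prod>i\<le>j. card (?T (j, i))) = card D * CARD('a) ^ j" by simp
  qed simp
  also have "\<dots> = card D ^ n * CARD('a) ^ (\<Sum>j<n. j)"
    by (simp add: prod.distrib power_sum)
  finally show ?thesis .
qed

lemma card_sym_mats:
  "card (sym_mats n :: 'a::{field,finite} mat set) = CARD('a) ^ (n + (\<Sum>j<n. j))"
  using card_sym_mats_diag_in[of n "UNIV :: 'a set"] by (simp add: power_add)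

lemma finite_sym_mats: "finite (sym_mats n :: 'a::{field,finite} mat set)"
  \<comment> \<open>An infinite set has \<open>card\<close> 0, while the count, obtained from a
    bijection, is positive.\<close>
  by (rule card_ge_0_finite) (simp add: card_sym_mats)

lemma finite_lines: "finite (lines n :: 'a::{field,finite} mat set set)"
  by (rule finite_subset[of _ "Pow (sym_mats n)"]) (auto simp: lines_def finite_sym_mats)

text \<open>The parametrization of the fibre is injective: \<open>a\<close> is recovered from the
  base point and \<open>c\<close> from a coordinate where \<open>x\<close> is nonzero.\<close>

lemma card_line_through_fibre:
  fixes S :: "'a::{field,finite} mat"
  assumes S: "S \<in> sym_mats n" and x: "x \<in> directions n"
  shows "card {(T, y). T \<in> sym_mats n \<and> y \<in> directions n \<and> line_through n T y = line_through n S x}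
    = CARD('a) * (CARD('a) - 1)"
proof -
  obtain i where i: "i < n" "x i \<noteq> 0" using x by (auto simp: directions_def)
  have "inj_on (\<lambda>(a, c). (translate n S x a, \<lambda>i\<in>{..<n}. c * x i)) (UNIV \<times> (UNIV - {0}))"
  proof (rule inj_onI)
    fix p p' :: "'a \<times> 'a"
    assume "(case p of (a, c) \<Rightarrow> (translate n S x a, \<lambda>i\<in>{..<n}. c * x i))
      = (case p' of (a, c) \<Rightarrow> (translate n S x a, \<lambda>i\<in>{..<n}. c * x i))"
    then have eq: "translate n S x (fst p) = translate n S x (fst p')"
      "(\<lambda>i\<in>{..<n}. snd p * x i) = (\<lambda>i\<in>{..<n}. snd p' * x i)"
      unfolding case_prod_unfold prod.inject by blast+
    have "snd p * x i = snd p' * x i" using fun_cong[OF eq(2), of i] i by simp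
    then show "p = p'" using eq(1) i by (simp add: translate_inject[OF x] prod_eq_iff)
  qed
  then show ?thesis
    unfolding line_through_fibre[OF S x] by (simp add: card_image card_cartesian_product card_Diff_subset)
qed

text \<open>Pairs of a point and a direction are counted by the line they give. The product form
  avoids division of natural numbers.\<close>

lemma card_lines:
  assumes "n \<ge> 1"
  shows "card (lines n :: 'a::{field,finite} mat set set) * (CARD('a) * (CARD('a) - 1))
    = card (sym_mats n :: 'a mat set) * (CARD('a) ^ n - 1)"
proof -
  let ?A = "sym_mats n \<times> directions n :: ('a mat \<times> (nat \<Rightarrow> 'a)) set"
  let ?f = "\<lambda>(S, x). line_through n S x :: 'a mat set"
  have fin: "finite ?A" using finite_sym_mats finite_directions by (rule finite_cartesian_product)
  have "card {p \<in> ?A. ?f p = M} = CARD('a) * (CARD('a) - 1)" if "M \<in> ?f ` ?A" for M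
  proof -
    obtain S x where Sx: "S \<in> sym_mats n" "x \<in> directions n" and M: "M = line_through n S x"
      using \<open>M \<in> ?f ` ?A\<close> by auto
    have "{p \<in> ?A. ?f p = M}
        = {(T, y). T \<in> sym_mats n \<and> y \<in> directions n \<and> line_through n T y = line_through n S x}"
      by (auto simp: M)
    then show ?thesis using card_line_through_fibre[OF Sx] by simp
  qed
  then have "card ?A = card (?f ` ?A) * (CARD('a) * (CARD('a) - 1))"
    using sum.image_gen[OF fin, of "\<lambda>_. 1::nat" ?f] by simp
  then show ?thesis
    unfolding lines_eq[OF assms, symmetric] by (simp add: card_cartesian_product card_directions)
qed

section \<open>Pivot lines and dimensions\<close>

definition diag_zeros :: "nat \<Rightarrow> 'a::field mat \<Rightarrow> nat set" where
  "diag_zeros n S = {i. i < n \<and> S $$ (i, i) = 0}"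

text \<open>Along this line only one diagonal entry changes. \<open>Min\<close> is meaningful only
  if the diagonal has a zero, which is the case for the points used as pivots.\<close>

definition pivot_line :: "nat \<Rightarrow> 'a::field mat \<Rightarrow> 'a mat set" where
  "pivot_line n S =
    line_through n S (\<lambda>i\<in>{..<n}. if i = Min (diag_zeros n S) then 1 else 0)"

lemma finite_diag_zeros: "finite (diag_zeros n S)"
  by (simp add: diag_zeros_def)

lemma card_diag_zeros_le: "card (diag_zeros n S) \<le> n"
  using card_mono[of "{..<n}" "diag_zeros n S"] by (auto simp: diag_zeros_def)

lemma pivot_line_in_lines:
  assumes S: "S \<in> sym_mats n" and ne: "diag_zeros n S \<noteq> {}"
  shows "pivot_line n S \<in> lines n"
proof -
  have "Min (diag_zeros n S) < n"
    using Min_in[OF finite_diag_zeros ne] by (simp add: diag_zeros_def)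
  then show ?thesis
    unfolding pivot_line_def by (intro line_through_in_lines S) (auto simp: directions_def)
qed

text \<open>Leaving \<open>S\<close> along its pivot line replaces the first zero on the diagonal by
  a nonzero \<open>a\<close> and keeps all other diagonal entries.\<close>

lemma diag_zeros_pivot_line:
  assumes S: "S \<in> sym_mats n" and ne: "diag_zeros n S \<noteq> {}"
    and T: "T \<in> pivot_line n S" "T \<noteq> S"
  shows "card (diag_zeros n T) < card (diag_zeros n S)"
proof -
  define p where "p = Min (diag_zeros n S)"
  define e :: "nat \<Rightarrow> 'a" where "e = (\<lambda>i\<in>{..<n}. if i = p then 1 else 0)"
  have p: "p \<in> diag_zeros n S" unfolding p_def by (rule Min_in[OF finite_diag_zeros ne])
  obtain a where a: "T = translate n S e a"
    using T(1) by (auto simp: pivot_line_def line_through_def e_def p_def)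
  have "a \<noteq> 0" using T(2) a translate_zero[OF S] by metis
  have T_diag: "T $$ (i, i) = (if i = p then a else S $$ (i, i))" if "i < n" for i
    using that p by (auto simp: a e_def diag_zeros_def)
  have "i \<in> diag_zeros n S - {p}" if "i \<in> diag_zeros n T" for i
    using that T_diag[of i] \<open>a \<noteq> 0\<close> by (cases "i = p") (simp_all add: diag_zeros_def)
  then have "diag_zeros n T \<subset> diag_zeros n S" using p by blast
  then show ?thesis by (intro psubset_card_mono finite_diag_zeros)
qed

lemma self_in_pivot_line: "S \<in> sym_mats n \<Longrightarrow> S \<in> pivot_line n S"
  by (simp add: pivot_line_def base_in_line)

text \<open>Two distinct points with the same pivot line would each have fewer diagonal zeros than
  the other.\<close>

lemma inj_on_pivot_line: "inj_on (pivot_line n) {S \<in> sym_mats n. diag_zeros n S \<noteq> {}}"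
proof (rule inj_onI, rule ccontr)
  fix S T assume *: "S \<in> {S \<in> sym_mats n. diag_zeros n S \<noteq> {}}"
    "T \<in> {S \<in> sym_mats n. diag_zeros n S \<noteq> {}}" "pivot_line n S = pivot_line n T" "S \<noteq> T"
  then have "T \<in> pivot_line n S" "S \<in> pivot_line n T" using self_in_pivot_line by auto
  then have "card (diag_zeros n T) < card (diag_zeros n S)" "card (diag_zeros n S) < card (diag_zeros n T)"
    using * by (auto intro!: diag_zeros_pivot_line)
  then show False by simp
qed

text \<open>Each pivot line gives an equation for its own point in terms of points with fewer
  diagonal zeros.\<close>

lemma dim_point_code_le:
  "binary.dim (point_code n :: ('a::{field,finite} mat \<Rightarrow> bit) set)
    \<le> card (sym_mats n :: 'a mat set) - card {S \<in> sym_mats n :: 'a mat set. diag_zeros n S \<noteq> {}}"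
  unfolding point_code_def
proof (rule dim_null_space_triangular_le[where r = "pivot_line n" and s = id
      and f = "\<lambda>S. card (diag_zeros n S)"])
  show "incidence (pivot_line n S) (id S) = 1"
    if "S \<in> {S \<in> sym_mats n :: 'a mat set. diag_zeros n S \<noteq> {}}" for S
    using that by (simp add: incidence_def self_in_pivot_line)
  show "card (diag_zeros n T) < card (diag_zeros n S)"
    if "S \<in> {S \<in> sym_mats n :: 'a mat set. diag_zeros n S \<noteq> {}}" "T \<noteq> S"
      "incidence (pivot_line n S) (id T) \<noteq> 0" for S T
    using that by (intro diag_zeros_pivot_line) (auto simp: incidence_def split: if_splits)
  show "pivot_line n ` {S \<in> sym_mats n :: 'a mat set. diag_zeros n S \<noteq> {}} \<subseteq> lines n"
    by (intro image_subsetI pivot_line_in_lines) auto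
qed (auto simp: finite_sym_mats)

text \<open>In the transposed system points give the equations and pivot lines are the unknowns, so
  the order is reversed: the other pivot lines through \<open>S\<close> belong to points with more
  diagonal zeros.\<close>

lemma dim_line_code_le:
  "binary.dim (line_code n :: ('a::{field,finite} mat set \<Rightarrow> bit) set)
    \<le> card (lines n :: 'a mat set set) - card {S \<in> sym_mats n :: 'a mat set. diag_zeros n S \<noteq> {}}"
  unfolding line_code_def
proof (rule dim_null_space_triangular_le[where s = "pivot_line n" and r = id
      and f = "\<lambda>S. n - card (diag_zeros n S)"])
  show "incidence (pivot_line n S) (id S) = 1"
    if "S \<in> {S \<in> sym_mats n :: 'a mat set. diag_zeros n S \<noteq> {}}" for S
    using that by (simp add: incidence_def self_in_pivot_line)
  show "n - card (diag_zeros n T) < n - card (diag_zeros n S)"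
    if "T \<in> {S \<in> sym_mats n :: 'a mat set. diag_zeros n S \<noteq> {}}" "T \<noteq> S"
      "incidence (pivot_line n T) (id S) \<noteq> 0" for S T
  proof -
    have "card (diag_zeros n S) < card (diag_zeros n T)"
      using that by (intro diag_zeros_pivot_line) (auto simp: incidence_def split: if_splits)
    \<comment> \<open>At most \<open>n\<close> diagonal zeros exist, so the truncated subtraction
      keeps the inequality strict.\<close>
    then show ?thesis using card_diag_zeros_le[of n T] by linarith
  qed
  show "pivot_line n ` {S \<in> sym_mats n :: 'a mat set. diag_zeros n S \<noteq> {}} \<subseteq> lines n"
    by (intro image_subsetI pivot_line_in_lines) auto
qed (auto simp: finite_lines inj_on_pivot_line)

lemma card_diag_zeros_nonempty:
  "card {S \<in> sym_mats n :: 'a::{field,finite} mat set. diag_zeros n S \<noteq> {}}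
    + (CARD('a) - 1) ^ n * CARD('a) ^ (\<Sum>j<n. j) = card (sym_mats n :: 'a mat set)"
proof -
  have eq: "{S \<in> sym_mats n :: 'a mat set. \<forall>i<n. S $$ (i, i) \<in> - {0}} = {S \<in> sym_mats n. diag_zeros n S = {}}"
    by (auto simp: diag_zeros_def)
  have "card (- {0 :: 'a}) = CARD('a) - 1" by (simp add: Compl_eq_Diff_UNIV card_Diff_subset)
  then have "card {S \<in> sym_mats n :: 'a mat set. diag_zeros n S = {}} = (CARD('a) - 1) ^ n * CARD('a) ^ (\<Sum>j<n. j)"
    using card_sym_mats_diag_in[of n "- {0 :: 'a}"] unfolding eq by simp
  moreover have "card (sym_mats n :: 'a mat set) = card {S \<in> sym_mats n :: 'a mat set. diag_zeros n S \<noteq> {}}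
      + card {S \<in> sym_mats n :: 'a mat set. diag_zeros n S = {}}"
    by (subst card_Un_disjoint[symmetric]) (auto simp: finite_sym_mats intro!: arg_cong[of _ _ card])
  ultimately show ?thesis by simp
qed

theorem theorem7:
  fixes n q :: nat
  assumes "primepow q" and "card (UNIV :: 'a::{field,finite} set) = q" and "n \<ge> 1"
  shows "binary_linear_code (sym_mats n) (point_code n :: ('a mat \<Rightarrow> bit) set) \<and>
    card (sym_mats n :: 'a mat set) = q ^ (n * (n + 1) div 2) \<and>
    binary.dim (point_code n :: ('a mat \<Rightarrow> bit) set)
      \<le> q ^ ((n\<^sup>2 - n) div 2) * (q - 1) ^ n \<and>
    binary_linear_code (lines n) (line_code n :: ('a mat set \<Rightarrow> bit) set) \<and>
    real (card (lines n :: 'a mat set set))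
      = (real q ^ n - 1) / (real q - 1) * real q ^ ((n\<^sup>2 + n - 2) div 2) \<and>
    real (binary.dim (line_code n :: ('a mat set \<Rightarrow> bit) set))
      \<le> (real q ^ n - 1) / (real q - 1) * real q ^ ((n\<^sup>2 + n - 2) div 2)
          - real q ^ (n * (n + 1) div 2)
          + real q ^ ((n\<^sup>2 - n) div 2) * (real q - 1) ^ n"
proof -
  define t where "t = (\<Sum>j<n. j)"
  define P where "P = {S \<in> sym_mats n :: 'a mat set. diag_zeros n S \<noteq> {}}"
  have q: "q \<ge> 2" using primepow_gt_Suc_0[OF assms(1)] by simp
  have nn: "n\<^sup>2 = 2 * t + n" using double_sum_lessThan[of n] by (simp add: t_def)
  \<comment> \<open>With \<open>t = n (n - 1) / 2\<close> all three exponents become free of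
    division.\<close>
  have exps: "n * (n + 1) div 2 = n + t" "(n\<^sup>2 - n) div 2 = t" "(n\<^sup>2 + n - 2) div 2 = n + t - 1"
    using nn by (simp_all add: power2_eq_square)
  have points: "card (sym_mats n :: 'a mat set) = q ^ (n + t)"
    using card_sym_mats[where 'a = 'a] assms(2) by (simp add: t_def)
  have P: "card P + q ^ t * (q - 1) ^ n = q ^ (n + t)"
    using card_diag_zeros_nonempty[of n, where 'a = 'a] assms(2) points
    by (simp add: P_def t_def mult.commute)
  \<comment> \<open>As \<open>n \<ge> 1\<close>, a factor \<open>q\<close> splits off
    \<open>q ^ (n + t)\<close> and then cancels against that of \<open>q * (q - 1)\<close>.\<close>
  have "card (lines n :: 'a mat set set) * (q * (q - 1)) = q * q ^ (n + t - 1) * (q ^ n - 1)"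
    using card_lines[OF assms(3), where 'a = 'a] assms(2,3) points
    by (simp flip: power_Suc)
  then have "card (lines n :: 'a mat set set) * (q - 1) = q ^ (n + t - 1) * (q ^ n - 1)"
    using q by simp
  then have "real (card (lines n :: 'a mat set set)) * (real q - 1)
      = real q ^ (n + t - 1) * (real q ^ n - 1)"
    using q arg_cong[of _ _ real] by (fastforce simp: of_nat_diff)
  then have lines: "real (card (lines n :: 'a mat set set))
      = (real q ^ n - 1) / (real q - 1) * real q ^ (n + t - 1)"
    using q by (simp add: field_simps)
  have point_dim: "binary.dim (point_code n :: ('a mat \<Rightarrow> bit) set) \<le> q ^ t * (q - 1) ^ n"
    using dim_point_code_le[of n, where 'a = 'a] P unfolding points P_def by linarith
  \<comment> \<open>This makes the natural subtraction in the dimension bound a genuine one, so that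
    it can be passed to the reals.\<close>
  have "card P \<le> card (lines n :: 'a mat set set)"
    using card_inj_on_le[OF inj_on_pivot_line _ finite_lines, of n] pivot_line_in_lines
    by (auto simp: P_def)
  then have "real (binary.dim (line_code n :: ('a mat set \<Rightarrow> bit) set))
      \<le> real (card (lines n :: 'a mat set set)) - real (card P)"
    using dim_line_code_le[of n, where 'a = 'a] unfolding P_def by linarith
  moreover have "real (card P) + real q ^ t * (real q - 1) ^ n = real q ^ (n + t)"
    using arg_cong[OF P, of real] q by (simp add: of_nat_diff)
  ultimately have line_dim: "real (binary.dim (line_code n :: ('a mat set \<Rightarrow> bit) set))
      \<le> (real q ^ n - 1) / (real q - 1) * real q ^ (n + t - 1)
        - real q ^ (n + t) + real q ^ t * (real q - 1) ^ n"
    unfolding lines by linarith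
  have codes: "binary_linear_code (sym_mats n) (point_code n :: ('a mat \<Rightarrow> bit) set)"
    "binary_linear_code (lines n) (line_code n :: ('a mat set \<Rightarrow> bit) set)"
    by (auto simp: binary_linear_code_def point_code_def line_code_def subspace_null_space
        finite_sym_mats finite_lines) (auto simp: null_space_def)
  show ?thesis unfolding exps using codes points point_dim lines line_dim by blast
qed

end
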